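(* Let $S$ be a transcendental semigroup. If the completely invariant Julia set $E(S)$ has non-empty interior, then $E(S)=\mathbb{C}$.
   Context: A transcendental semigroup $S=\langle f_\alpha\rangle_{\alpha\in\Delta}$ is the semigroup generated under composition by a (finite or infinite) family $\{f_\alpha\}_{\alpha\in\Delta}$ of transcendental entire functions $f_\alpha:\mathbb{C}\to\mathbb{C}$: its elements are all finite compositions $f_{\alpha_1}\circ f_{\alpha_2}\circ\cdots\circ f_{\alpha_m}$, $m\ge 1$. For a map $f:\mathbb{C}\to\mathbb{C}$, a subset $U\subset\mathbb{C}$ is completely invariant under $f$ if $f(U)\subset U$ and $f^{-1}(U)\subset U$. The completely invariant Julia set of $S$ is $$E(S)=\bigcap\{E\subset\mathbb{C}: E \text{ is closed in } \mathbb{C},\ E \text{ is completely invariant under each } f\in S,\ \#(E)\ge 3\},$$ where $\#(E)$ denotes the cardinality of $E$. *)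

theory Defs
  imports "HOL-Complex_Analysis.Complex_Analysis" "HOL-Computational_Algebra.Polynomial"
begin

definition transcendental_entire :: "(complex \<Rightarrow> complex) \<Rightarrow> bool" where
  "transcendental_entire f \<longleftrightarrow> f holomorphic_on UNIV \<and> \<not> (\<exists>p. f = poly p)"

(* All compositions of m \<ge> 1 members of F; no identity is adjoined. *)
inductive_set generated_semigroup :: "(complex \<Rightarrow> complex) set \<Rightarrow> (complex \<Rightarrow> complex) set"
  for F where
  generator: "f \<in> F \<Longrightarrow> f \<in> generated_semigroup F"
| compose: "f \<in> F \<Longrightarrow> g \<in> generated_semigroup F \<Longrightarrow> f \<circ> g \<in> generated_semigroup F"

(* The generating family enters only through its range, so it is given as a set F of
   functions, of arbitrary cardinality.  The empty family is not excluded. *)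
definition transcendental_semigroup :: "(complex \<Rightarrow> complex) set \<Rightarrow> bool" where
  "transcendental_semigroup S \<longleftrightarrow>
     (\<exists>F. (\<forall>f\<in>F. transcendental_entire f) \<and> S = generated_semigroup F)"

definition completely_invariant :: "(complex \<Rightarrow> complex) \<Rightarrow> complex set \<Rightarrow> bool" where
  "completely_invariant f U \<longleftrightarrow> f ` U \<subseteq> U \<and> f -` U \<subseteq> U"

(* Infinite E needs its own disjunct, since card E = 0 in that case. *)
definition completely_invariant_Julia :: "(complex \<Rightarrow> complex) set \<Rightarrow> complex set" where
  "completely_invariant_Julia S =
     \<Inter> {E. closed E \<and> (\<forall>f\<in>S. completely_invariant f E) \<and> (infinite E \<or> card E \<ge> 3)}"

end

theory Submission
  imports Defs
begin

text \<open>
  The set \<open>E = E(S)\<close> is itself closed and completely invariant under \<open>S\<close>. Every member of \<open>S\<close> is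
  a continuous open map, and if such a map leaves a closed set completely invariant, then it does
  the same to the interior of that set and hence to its frontier
  (\<open>completely_invariant_frontier_closed\<close>).

  Suppose that \<open>E\<close> has interior but is not the whole plane. Then the frontier of \<open>E\<close> separates the
  interior of \<open>E\<close> from the complement of \<open>E\<close>; as a finite set does not disconnect the plane,
  the frontier is infinite (\<open>infinite_frontier\<close>). So the frontier is one of the sets whose
  intersection defines \<open>E\<close>, and \<open>E\<close> is contained in its own frontier. This contradicts the
  existence of an interior point.
\<close>

text \<open>This form makes complete invariance pass to intersections and differences, because preimages
  commute with both.\<close>

lemma completely_invariant_iff_vimage_eq:
  "completely_invariant f U \<longleftrightarrow> f -` U = U"
  unfolding completely_invariant_def image_subset_iff_subset_vimage set_eq_subset
  by (rule conj_commute)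

lemma transcendental_entire_not_constant:
  assumes "transcendental_entire f"
  shows "\<not> f constant_on UNIV"
proof
  assume "f constant_on UNIV"
  then obtain c where "\<And>z. f z = c"
    unfolding constant_on_def by blast
  then have "f = poly [:c:]"
    by (intro ext) simp
  with assms show False
    unfolding transcendental_entire_def by blast
qed

text \<open>Openness and continuity pass to compositions, so it is enough to apply the open mapping
  theorem to the generators.\<close>

lemma generated_semigroup_continuous_open:
  assumes "f \<in> generated_semigroup F" and F: "\<And>g. g \<in> F \<Longrightarrow> transcendental_entire g"
  shows "continuous_on UNIV f \<and> (\<forall>U. open U \<longrightarrow> open (f ` U))"
proof -
  have gen: "continuous_on UNIV g \<and> (\<forall>U. open U \<longrightarrow> open (g ` U))" if "g \<in> F" for g
  proof -
    have "g holomorphic_on UNIV" "\<not> g constant_on UNIV"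
      using F[OF that] transcendental_entire_not_constant
      unfolding transcendental_entire_def by blast+
    then show ?thesis
      by (intro conjI allI impI holomorphic_on_imp_continuous_on open_mapping_thm[of g UNIV])
         (simp_all add: convex_connected)
  qed
  from assms(1) show ?thesis
  proof (induction rule: generated_semigroup.induct)
    case (compose f g)
    have "continuous_on UNIV (f \<circ> g)"
      using gen[OF compose.hyps(1)] compose.IH
      by (intro continuous_on_compose) (blast intro: continuous_on_subset[OF _ subset_UNIV])+
    moreover have "open ((f \<circ> g) ` U)" if "open U" for U
      using gen[OF compose.hyps(1)] compose.IH that
      unfolding image_comp[symmetric] by blast
    ultimately show ?case by blast
  qed (rule gen)
qed

text \<open>Continuity pulls a neighbourhood of \<open>f z\<close> inside \<open>U\<close> back to one of \<open>z\<close>; openness pushes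
  a neighbourhood of \<open>z\<close> inside \<open>U\<close> forward to one of \<open>f z\<close>.\<close>

lemma completely_invariant_interior:
  assumes "continuous_on UNIV f" and "\<And>V. open V \<Longrightarrow> open (f ` V)"
    and inv: "completely_invariant f U"
  shows "completely_invariant f (interior U)"
proof -
  have "f ` interior U \<subseteq> U"
    using inv image_mono[OF interior_subset, of f U] unfolding completely_invariant_def
    by (meson order_trans)
  then have "f ` interior U \<subseteq> interior U"
    using assms(2) by (intro interior_maximal) simp_all
  moreover have "f -` interior U \<subseteq> U"
    using inv vimage_mono[OF interior_subset, of f U] unfolding completely_invariant_def
    by (meson order_trans)
  then have "f -` interior U \<subseteq> interior U"
    using assms(1) by (intro interior_maximal open_vimage) simp_all
  ultimately show ?thesis
    unfolding completely_invariant_def by (rule conjI)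
qed

lemma completely_invariant_frontier_closed:
  assumes "continuous_on UNIV f" and "\<And>V. open V \<Longrightarrow> open (f ` V)"
    and "completely_invariant f U" and "closed U"
  shows "completely_invariant f (frontier U)"
  using completely_invariant_interior[OF assms(1-3)] assms(3,4)
  by (simp add: completely_invariant_iff_vimage_eq frontier_def vimage_Diff)

lemma infinite_frontier:
  fixes U :: "complex set"
  assumes "interior U \<noteq> {}" and "closure U \<noteq> UNIV"
  shows "infinite (frontier U)"
proof
  assume "finite (frontier U)"
  then have "connected (- frontier U)"
    by (intro path_connected_imp_connected path_connected_complement_countable)
       (auto intro: countable_finite)
  \<comment> \<open>Off the frontier, the plane splits into the interior and the exterior of \<open>U\<close>.\<close>
  moreover have "- frontier U = interior U \<union> - closure U"
    using interior_subset[of U] closure_subset[of U] by (auto simp: frontier_def)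
  moreover have "interior U \<inter> - closure U = {}"
    using interior_subset[of U] closure_subset[of U] by blast
  ultimately show False
    using assms connectedD[of "- frontier U" "interior U" "- closure U"] by auto
qed

lemma closed_completely_invariant_Julia: "closed (completely_invariant_Julia S)"
  unfolding completely_invariant_Julia_def by blast

lemma completely_invariant_Julia_invariant:
  assumes "f \<in> S"
  shows "completely_invariant f (completely_invariant_Julia S)"
proof -
  let ?\<E> = "{E. closed E \<and> (\<forall>f\<in>S. completely_invariant f E) \<and> (infinite E \<or> card E \<ge> 3)}"
  have "f -` \<Inter> ?\<E> = (\<Inter>E\<in>?\<E>. f -` E)"
    by auto
  also have "\<dots> = (\<Inter>E\<in>?\<E>. E)"
    using assms by (intro INF_cong) (auto simp only: completely_invariant_iff_vimage_eq mem_Collect_eq)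
  finally show ?thesis
    unfolding completely_invariant_Julia_def completely_invariant_iff_vimage_eq by simp
qed

theorem theorem1p3:
  fixes S :: "(complex \<Rightarrow> complex) set"
  assumes "transcendental_semigroup S"
    and "interior (completely_invariant_Julia S) \<noteq> {}"
  shows "completely_invariant_Julia S = UNIV"
proof (rule ccontr)
  let ?E = "completely_invariant_Julia S"
  assume "?E \<noteq> UNIV"
  then have "infinite (frontier ?E)"
    using assms(2) closed_completely_invariant_Julia
    by (intro infinite_frontier) auto
  moreover have "completely_invariant f (frontier ?E)" if f: "f \<in> S" for f
  proof -
    have "continuous_on UNIV f \<and> (\<forall>U. open U \<longrightarrow> open (f ` U))"
      using assms(1) f generated_semigroup_continuous_open
      unfolding transcendental_semigroup_def by blast
    then show ?thesis
      using completely_invariant_Julia_invariant[OF f] closed_completely_invariant_Julia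
      by (intro completely_invariant_frontier_closed) auto
  qed
  ultimately have "?E \<subseteq> frontier ?E"
    unfolding completely_invariant_Julia_def[of S] by (intro Inter_lower) auto
  with assms(2) interior_subset[of ?E] show False
    unfolding frontier_def by blast
qed

end
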